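(* Let $V$ be the set of elements of $\widehat V$ that have at least one representative that is simple and balanced, and let $BV$ be the set of elements of $\widehat{BV}$ that have at least one representative that is simple and balanced. Then both $V$ and $BV$ are groups (under the multiplications of $\widehat V$ and $\widehat{BV}$, respectively).
   Context: Forests. $\mathbb N=\{0,1,2,\dots\}$. A tree is a finite non-empty set $T$ of finite strings over $\{0,1\}$, closed under taking prefixes, with $u0\in T$ if and only if $u1\in T$. Its leaves are the $u\in T$ with $u0,u1\notin T$, ordered left to right (lexicographically); $T$ is trivial if it consists only of the empty string. A forest is a sequence $F=(F_0,F_1,\dots)$ of trees, all but finitely many trivial. The leaves of $F$ are numbered $0,1,2,\dots$ so that all leaves of $F_i$ precede all leaves of $F_j$ when $i<j$, and leaves of one tree are ordered left to right. The product $FG$ attaches $G_j$ at the $j$-th leaf of $F$: $(FG)_i=F_i\cup\bigcup vG_j$, the union over leaves $v$ of $F_i$, where $j$ is the number of $v$ as a leaf of $F$ and $vG_j=\{vu\mid u\in G_j\}$. The set $\mathcal F$ of all forests is a monoid under this product, whose identity is the forest with all trees trivial. $\lambda_i$ denotes the forest whose only non-trivial tree is the $i$-th one, which consists of the empty string, $0$ and $1$. The $\lambda_i$ generate $\mathcal F$. Permutations and braids. $S_\infty$ is the group of finitary permutations of $\mathbb N$, $\sigma_m$ is the transposition of $m$ and $m+1$, and $(\sigma\tau)(i)=\sigma(\tau(i))$. $B_\infty$ is the braid group on infinitely many strands: generators $\sigma_0,\sigma_1,\dots$, relations $\sigma_m\sigma_n=\sigma_n\sigma_m$ for $|m-n|\ge2$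 and $\sigma_m\sigma_{m+1}\sigma_m=\sigma_{m+1}\sigma_m\sigma_{m+1}$. $S_k\le S_\infty$ and $B_k\le B_\infty$ are the subgroups generated by $\sigma_0,\dots,\sigma_{k-2}$. Zappa–Szép products. For $A=S_\infty$ or $A=B_\infty$ there are uniquely determined functions $A\times\mathcal F\to\mathcal F$, $(\alpha,u)\mapsto\alpha\cdot u$, and $A\times\mathcal F\to A$, $(\alpha,u)\mapsto\alpha^u$, satisfying, for all $\alpha,\beta\in A$, $u,v\in\mathcal F$: $(\alpha\beta)\cdot u=\alpha\cdot(\beta\cdot u)$, $(\alpha\beta)^u=\alpha^{(\beta\cdot u)}\beta^u$, $\alpha\cdot(uv)=(\alpha\cdot u)(\alpha^u\cdot v)$, $\alpha^{uv}=(\alpha^u)^v$, $\alpha^1=\alpha$, $1\cdot u=u$, $\alpha\cdot1=1$, $1^u=1$, and given on generators ($\epsilon=\pm1$, $\sigma_q(m)$ meaning the value of the transposition) by $\sigma_q^\epsilon\cdot\lambda_m=\lambda_{\sigma_q(m)}$ and $(\sigma_q^\epsilon)^{\lambda_m}=\sigma_{q+1}^\epsilon$ if $m<q$; $\sigma_q^\epsilon\sigma_{q+1}^\epsilon$ if $m=q$; $\sigma_{q+1}^\epsilon\sigma_q^\epsilon$ if $m=q+1$; $\sigma_q^\epsilon$ if $m>q+1$. $\mathcal F\bowtie A$ is the set $\mathcal F\times A$ with product $(u,\alpha)(v,\beta)=(u(\alpha\cdot v),\alpha^v\beta)$, a monoid; $(u,\alpha)$ is written $u\alpha$. The group of right fractions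 of a cancellative monoid $M$ in which any two elements have a common right multiple is the (unique up to isomorphism) group containing $M$ as a submonoid in which every element has the form $uv^{-1}$ with $u,v\in M$; the pair $(u,v)$ is then called a representative of that element. The monoids $\mathcal F\bowtie S_\infty$ and $\mathcal F\bowtie B_\infty$ are cancellative with common right multiples; $\widehat V$ and $\widehat{BV}$ denote their respective groups of right fractions. Simple elements. A forest $F$ is simple if $F_i$ is trivial for all $i>0$; it is simple of type $k$ if moreover $F_0$ has exactly $k+1$ leaves. An element $F\beta$ with $F\in\mathcal F$ and $\beta\in S_\infty$ (resp. $B_\infty$) is simple of type $k$ if $F$ is simple of type $k$ and $\beta\in S_{k+1}$ (resp. $B_{k+1}$); it is simple if it is simple of some type. A pair of elements of $\mathcal F\bowtie S_\infty$ (or of $\mathcal F\bowtie B_\infty$) is simple and balanced if both entries are simple and have the same type. *)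

theory Defs
  imports "HOL-Algebra.Generated_Groups" "HOL-Combinatorics.Transposition"
begin

section \<open>Forests\<close>

text \<open>Strings over \<open>{0,1}\<close> are Boolean lists, with \<open>0\<close> encoded as \<open>False\<close> and \<open>1\<close> as \<open>True\<close>.\<close>

type_synonym tree = "bool list set"
type_synonym forest = "nat \<Rightarrow> tree"

definition is_tree :: "tree \<Rightarrow> bool" where
  "is_tree T \<longleftrightarrow> finite T \<and> T \<noteq> {}
     \<and> (\<forall>u v. u @ v \<in> T \<longrightarrow> u \<in> T)
     \<and> (\<forall>u. u @ [False] \<in> T \<longleftrightarrow> u @ [True] \<in> T)"

definition trivial_tree :: tree where
  "trivial_tree = {[]}"

definition leaves :: "tree \<Rightarrow> bool list set" where
  "leaves T = {u \<in> T. u @ [False] \<notin> T \<and> u @ [True] \<notin> T}"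

definition forests :: "forest set" where
  "forests = {F. (\<forall>i. is_tree (F i)) \<and> finite {i. F i \<noteq> trivial_tree}}"

text \<open>The number, counted from \<open>0\<close>, of the leaf \<open>v\<close> of \<open>F i\<close> among all leaves of \<open>F\<close>.\<close>

definition leaf_number :: "forest \<Rightarrow> nat \<Rightarrow> bool list \<Rightarrow> nat" where
  "leaf_number F i v =
     (\<Sum>j<i. card (leaves (F j))) + card {w \<in> leaves (F i). (w, v) \<in> lexord {(False, True)}}"

definition forest_mult :: "forest \<Rightarrow> forest \<Rightarrow> forest" where
  "forest_mult F G = (\<lambda>i. F i \<union> (\<Union>v \<in> leaves (F i). {v @ u | u. u \<in> G (leaf_number F i v)}))"

definition forest_one :: forest where
  "forest_one = (\<lambda>_. trivial_tree)"

definition caret :: "nat \<Rightarrow> forest" where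
  "caret i = forest_one (i := {[], [False], [True]})"

section \<open>Finitary permutations and braids\<close>

definition S_inf :: "(nat \<Rightarrow> nat) monoid" where
  "S_inf = \<lparr>carrier = {p. bij p \<and> finite {i. p i \<noteq> i}}, monoid.mult = (\<circ>), one = id\<rparr>"

definition S_gen :: "nat \<Rightarrow> nat \<Rightarrow> nat" where
  "S_gen m = transpose m (Suc m)"

text \<open>A letter \<open>(m, True)\<close> stands for \<open>\<sigma>\<^sub>m\<close>, and \<open>(m, False)\<close> for its inverse.\<close>

type_synonym braid_word = "(nat \<times> bool) list"

inductive braid_eq :: "braid_word \<Rightarrow> braid_word \<Rightarrow> bool" where
  refl: "braid_eq u u"
| sym: "braid_eq u v \<Longrightarrow> braid_eq v u"
| trans: "braid_eq u v \<Longrightarrow> braid_eq v w \<Longrightarrow> braid_eq u w"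
| append: "braid_eq u u' \<Longrightarrow> braid_eq v v' \<Longrightarrow> braid_eq (u @ v) (u' @ v')"
| cancel: "braid_eq [(m, e), (m, \<not> e)] []"
| far: "\<bar>int m - int n\<bar> \<ge> 2 \<Longrightarrow> braid_eq [(m, True), (n, True)] [(n, True), (m, True)]"
| near: "braid_eq [(m, True), (Suc m, True), (m, True)] [(Suc m, True), (m, True), (Suc m, True)]"

quotient_type braid = braid_word / braid_eq
  by (intro equivpI reflpI sympI transpI) (blast intro: braid_eq.intros)+

lift_definition braid_mult :: "braid \<Rightarrow> braid \<Rightarrow> braid" is "(@)"
  by (rule braid_eq.append)

lift_definition braid_one :: braid is "[]" .

lift_definition braid_gen :: "nat \<Rightarrow> braid" is "\<lambda>m. [(m, True)]" .

definition B_inf :: "braid monoid" where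
  "B_inf = \<lparr>carrier = UNIV, monoid.mult = braid_mult, one = braid_one\<rparr>"

lemma group_S_inf: "group S_inf"
proof (rule groupI)
  fix p q assume "p \<in> carrier S_inf" "q \<in> carrier S_inf"
  then have *: "bij p" "bij q" "finite ({i. p i \<noteq> i} \<union> {i. q i \<noteq> i})"
    by (auto simp: S_inf_def)
  have "{i. (p \<circ> q) i \<noteq> i} \<subseteq> {i. p i \<noteq> i} \<union> {i. q i \<noteq> i}"
    by auto
  with * show "p \<otimes>\<^bsub>S_inf\<^esub> q \<in> carrier S_inf"
    by (auto simp: S_inf_def bij_comp intro: finite_subset)
next
  fix p assume "p \<in> carrier S_inf"
  then have p: "bij p" "finite {i. p i \<noteq> i}"
    by (auto simp: S_inf_def)
  have "{i. inv_into UNIV p i \<noteq> i} \<subseteq> {i. p i \<noteq> i}"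
    using p(1) by (auto simp: bij_def inv_f_eq)
  with p have "inv_into UNIV p \<in> carrier S_inf"
    by (auto simp: S_inf_def bij_imp_bij_inv intro: finite_subset)
  moreover have "inv_into UNIV p \<otimes>\<^bsub>S_inf\<^esub> p = \<one>\<^bsub>S_inf\<^esub>"
    using p(1) by (simp add: S_inf_def bij_def)
  ultimately show "\<exists>q\<in>carrier S_inf. q \<otimes>\<^bsub>S_inf\<^esub> p = \<one>\<^bsub>S_inf\<^esub>"
    by blast
qed (auto simp: S_inf_def)

lemma braid_word_left_inverse: "\<exists>v. braid_eq (v @ u) []"
proof (induction u)
  case Nil
  show ?case
    by (rule exI [of _ "[]"]) (simp add: braid_eq.refl)
next
  case (Cons x u)
  obtain m e where x: "x = (m, e)"
    by (cases x)
  obtain v where v: "braid_eq (v @ u) []"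
    using Cons.IH by blast
  have "braid_eq ([(m, \<not> e), (m, \<not> \<not> e)] @ u) ([] @ u)"
    by (intro braid_eq.append braid_eq.cancel braid_eq.refl)
  then have "braid_eq (v @ ([(m, \<not> e), (m, e)] @ u)) (v @ u)"
    by (intro braid_eq.append braid_eq.refl) simp
  then have "braid_eq ((v @ [(m, \<not> e)]) @ x # u) []"
    using v by (auto simp: x intro: braid_eq.trans)
  then show ?case
    by blast
qed

lemma group_B_inf: "group B_inf"
proof (rule groupI)
  fix a b c
  show "a \<otimes>\<^bsub>B_inf\<^esub> b \<otimes>\<^bsub>B_inf\<^esub> c = a \<otimes>\<^bsub>B_inf\<^esub> (b \<otimes>\<^bsub>B_inf\<^esub> c)"
    unfolding B_inf_def monoid.simps by transfer (simp add: braid_eq.refl)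
next
  fix a
  show "\<one>\<^bsub>B_inf\<^esub> \<otimes>\<^bsub>B_inf\<^esub> a = a"
    unfolding B_inf_def monoid.simps by transfer (simp add: braid_eq.refl)
next
  fix a
  have "\<exists>b. braid_mult b a = braid_one"
    by transfer (rule braid_word_left_inverse)
  then show "\<exists>b\<in>carrier B_inf. b \<otimes>\<^bsub>B_inf\<^esub> a = \<one>\<^bsub>B_inf\<^esub>"
    by (simp add: B_inf_def)
qed (simp_all add: B_inf_def)

text \<open>The subgroup generated by \<open>\<sigma>\<^sub>0, \<dots>, \<sigma>\<^bsub>k-2\<^esub>\<close>, avoiding truncated subtraction; it is trivial for \<open>k \<le> 1\<close>.\<close>

definition strand_subgroup :: "'a monoid \<Rightarrow> (nat \<Rightarrow> 'a) \<Rightarrow> nat \<Rightarrow> 'a set" where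
  "strand_subgroup A s k = generate A (s ` {i. i + 2 \<le> k})"

section \<open>Zappa--Szep products with the forest monoid\<close>

text \<open>Here \<open>s q\<close> plays the role of \<open>\<sigma>\<^sub>q\<close>, \<open>act \<alpha> u\<close> is \<open>\<alpha> \<cdot> u\<close> and \<open>ex \<alpha> u\<close> is \<open>\<alpha>\<^sup>u\<close>.
  For \<open>S_inf\<close> and \<open>B_inf\<close> there is exactly one such pair of functions
  (up to values outside \<open>carrier A\<close> and \<open>forests\<close>).\<close>

locale zappa_szep = group A for A :: "'a monoid" (structure) +
  fixes s :: "nat \<Rightarrow> 'a"
    and act :: "'a \<Rightarrow> forest \<Rightarrow> forest"
    and ex :: "'a \<Rightarrow> forest \<Rightarrow> 'a"
  assumes act_closed: "\<lbrakk>\<alpha> \<in> carrier A; u \<in> forests\<rbrakk> \<Longrightarrow> act \<alpha> u \<in> forests"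
    and ex_closed: "\<lbrakk>\<alpha> \<in> carrier A; u \<in> forests\<rbrakk> \<Longrightarrow> ex \<alpha> u \<in> carrier A"
    and act_mult: "\<lbrakk>\<alpha> \<in> carrier A; \<beta> \<in> carrier A; u \<in> forests\<rbrakk>
          \<Longrightarrow> act (\<alpha> \<otimes> \<beta>) u = act \<alpha> (act \<beta> u)"
    and ex_mult: "\<lbrakk>\<alpha> \<in> carrier A; \<beta> \<in> carrier A; u \<in> forests\<rbrakk>
          \<Longrightarrow> ex (\<alpha> \<otimes> \<beta>) u = ex \<alpha> (act \<beta> u) \<otimes> ex \<beta> u"
    and act_forest_mult: "\<lbrakk>\<alpha> \<in> carrier A; u \<in> forests; v \<in> forests\<rbrakk>
          \<Longrightarrow> act \<alpha> (forest_mult u v) = forest_mult (act \<alpha> u) (act (ex \<alpha> u) v)"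
    and ex_forest_mult: "\<lbrakk>\<alpha> \<in> carrier A; u \<in> forests; v \<in> forests\<rbrakk>
          \<Longrightarrow> ex \<alpha> (forest_mult u v) = ex (ex \<alpha> u) v"
    and ex_forest_one: "\<alpha> \<in> carrier A \<Longrightarrow> ex \<alpha> forest_one = \<alpha>"
    and act_one: "u \<in> forests \<Longrightarrow> act \<one> u = u"
    and act_forest_one: "\<alpha> \<in> carrier A \<Longrightarrow> act \<alpha> forest_one = forest_one"
    and ex_one: "u \<in> forests \<Longrightarrow> ex \<one> u = \<one>"
    and act_gen: "e \<in> {1, - 1 :: int}
          \<Longrightarrow> act (s q [^] e) (caret m) = caret (transpose q (Suc q) m)"
    and ex_gen: "e \<in> {1, - 1 :: int}
          \<Longrightarrow> ex (s q [^] e) (caret m) =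
                (if m < q then s (q + 1) [^] e
                 else if m = q then s q [^] e \<otimes> s (q + 1) [^] e
                 else if m = q + 1 then s (q + 1) [^] e \<otimes> s q [^] e
                 else s q [^] e)"

definition zs_product ::
  "'a monoid \<Rightarrow> ('a \<Rightarrow> forest \<Rightarrow> forest) \<Rightarrow> ('a \<Rightarrow> forest \<Rightarrow> 'a) \<Rightarrow> (forest \<times> 'a) monoid" where
  "zs_product A act ex =
     \<lparr>carrier = forests \<times> carrier A,
      monoid.mult = (\<lambda>(u, \<alpha>) (v, \<beta>). (forest_mult u (act \<alpha> v), ex \<alpha> v \<otimes>\<^bsub>A\<^esub> \<beta>)),
      one = (forest_one, \<one>\<^bsub>A\<^esub>)\<rparr>"

section \<open>Groups of right fractions\<close>

text \<open>\<open>\<iota>\<close> embeds \<open>M\<close> as a submonoid into \<open>G\<close>.\<close>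

definition right_fraction_group :: "'m monoid \<Rightarrow> 'g monoid \<Rightarrow> ('m \<Rightarrow> 'g) \<Rightarrow> bool" where
  "right_fraction_group M G \<iota> \<longleftrightarrow>
     group G \<and> \<iota> \<in> hom M G \<and> \<iota> \<one>\<^bsub>M\<^esub> = \<one>\<^bsub>G\<^esub> \<and> inj_on \<iota> (carrier M)
     \<and> (\<forall>g \<in> carrier G. \<exists>u \<in> carrier M. \<exists>v \<in> carrier M. g = \<iota> u \<otimes>\<^bsub>G\<^esub> inv\<^bsub>G\<^esub> \<iota> v)"

definition representative :: "'m monoid \<Rightarrow> 'g monoid \<Rightarrow> ('m \<Rightarrow> 'g) \<Rightarrow> 'm \<times> 'm \<Rightarrow> 'g \<Rightarrow> bool" where
  "representative M G \<iota> p g \<longleftrightarrow>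
     fst p \<in> carrier M \<and> snd p \<in> carrier M \<and> g = \<iota> (fst p) \<otimes>\<^bsub>G\<^esub> inv\<^bsub>G\<^esub> \<iota> (snd p)"

section \<open>Simple elements\<close>

definition simple_forest :: "forest \<Rightarrow> bool" where
  "simple_forest F \<longleftrightarrow> F \<in> forests \<and> (\<forall>i>0. F i = trivial_tree)"

definition simple_forest_type :: "nat \<Rightarrow> forest \<Rightarrow> bool" where
  "simple_forest_type k F \<longleftrightarrow> simple_forest F \<and> card (leaves (F 0)) = k + 1"

definition simple_type :: "'a monoid \<Rightarrow> (nat \<Rightarrow> 'a) \<Rightarrow> nat \<Rightarrow> forest \<times> 'a \<Rightarrow> bool" where
  "simple_type A s k x \<longleftrightarrow>
     simple_forest_type k (fst x) \<and> snd x \<in> strand_subgroup A s (k + 1)"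

definition simple_balanced ::
  "'a monoid \<Rightarrow> (nat \<Rightarrow> 'a) \<Rightarrow> (forest \<times> 'a) \<times> (forest \<times> 'a) \<Rightarrow> bool" where
  "simple_balanced A s p \<longleftrightarrow> (\<exists>k. simple_type A s k (fst p) \<and> simple_type A s k (snd p))"

definition simple_balanced_fractions ::
  "'a monoid \<Rightarrow> (nat \<Rightarrow> 'a) \<Rightarrow> (forest \<times> 'a) monoid \<Rightarrow> 'g monoid \<Rightarrow> (forest \<times> 'a \<Rightarrow> 'g) \<Rightarrow> 'g set" where
  "simple_balanced_fractions A s M G \<iota> =
     {g \<in> carrier G. \<exists>p. representative M G \<iota> p g \<and> simple_balanced A s p}"

end

theory Submission
  imports Defs
begin

text \<open>
  Write an element of the set in question as \<open>x y\<inverse>\<close> with \<open>x = F\<alpha>\<close> and \<open>y = H\<beta>\<close> simple of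
  the same type \<open>k\<close>. Multiplying both entries on the right by \<open>\<beta>\<inverse>\<close> turns the denominator
  into the bare forest \<open>H\<close> and the numerator into \<open>F\<eta>\<close> with \<open>\<eta> = \<alpha>\<beta>\<inverse>\<close>. Multiplying both
  entries on the right by a caret \<open>\<lambda>\<^sub>m\<close> with \<open>m \<le> k\<close> turns \<open>F\<eta>\<close> into \<open>F\<lambda>\<^bsub>m'\<^esub>\<eta>'\<close> for some
  \<open>m' \<le> k\<close>, where \<open>\<eta>' = ex \<eta> \<lambda>\<^sub>m\<close> lies on one strand more than \<open>\<eta>\<close>, and turns \<open>H\<close>
  into \<open>H\<lambda>\<^sub>m\<close>. So the fraction stays simple and balanced, and the denominator has grown by a
  caret at its \<open>m\<close>-th leaf
  (\<open>act_caret_strand\<close>, \<open>fraction_add_caret\<close>). A finite tree containing the tree \<open>H\<^sub>0\<close> arises from it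
  by adding carets at leaves one at a time, so the denominator can be made equal to any
  tree that contains \<open>H\<^sub>0\<close> (\<open>fraction_grow\<close>).

  Closure under inverses holds because the condition on a pair is symmetric. For a product of
  \<open>g\<close> and \<open>h\<close>, both \<open>g\<close> and \<open>h\<inverse>\<close> are given the same denominator, the union \<open>T\<close> of the two trees
  involved: \<open>g = x T\<inverse>\<close> and \<open>h\<inverse> = y T\<inverse>\<close> with \<open>x\<close> and \<open>y\<close> of the type of \<open>T\<close>, whence
  \<open>g h = x y\<inverse>\<close>.

  Permutations and braids are treated at once, as a group with generators \<open>s\<close> that act on carets
  by the given formulas.
\<close>

section \<open>Adding carets to trees\<close>

definition add_caret :: "bool list \<Rightarrow> tree \<Rightarrow> tree" where
  "add_caret v T = T \<union> {v @ [False], v @ [True]}"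

lemma root_in_tree: "is_tree T \<Longrightarrow> [] \<in> T"
  unfolding is_tree_def by (metis append_Nil ex_in_conv)

lemma finite_leaves: "is_tree T \<Longrightarrow> finite (leaves T)"
  by (simp add: is_tree_def leaves_def)

lemma is_tree_trivial: "is_tree trivial_tree"
  by (auto simp: is_tree_def trivial_tree_def)

lemma leaves_trivial: "leaves trivial_tree = {[]}"
  by (auto simp: leaves_def trivial_tree_def)

lemma is_tree_Un: "is_tree T \<Longrightarrow> is_tree U \<Longrightarrow> is_tree (T \<union> U)"
  unfolding is_tree_def by blast

lemma is_tree_add_caret:
  assumes T: "is_tree T" and v: "v \<in> leaves T"
  shows "is_tree (add_caret v T)"
  unfolding is_tree_def
proof (intro conjI allI impI)
  show "finite (add_caret v T)" "add_caret v T \<noteq> {}"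
    using T by (auto simp: is_tree_def add_caret_def)
next
  fix u w assume uw: "u @ w \<in> add_caret v T"
  show "u \<in> add_caret v T"
  proof (cases w rule: rev_cases)
    case Nil
    with uw show ?thesis by simp
  next
    case (snoc w' b)
    have "u @ w' \<in> T"
      using uw snoc T v unfolding is_tree_def add_caret_def leaves_def
      by (auto simp flip: append_assoc)
    then show ?thesis
      using T unfolding is_tree_def add_caret_def by blast
  qed
next
  fix u show "u @ [False] \<in> add_caret v T \<longleftrightarrow> u @ [True] \<in> add_caret v T"
    using T by (auto simp: is_tree_def add_caret_def)
qed

lemma card_leaves_add_caret:
  assumes T: "is_tree T" and v: "v \<in> leaves T"
  shows "card (leaves (add_caret v T)) = Suc (card (leaves T))"
proof -
  have prefix: "u \<in> T" if "u @ w \<in> T" for u w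
    using T that by (auto simp: is_tree_def)
  have notin: "v @ [b] \<notin> T" "v @ [b, c] \<notin> T" for b c
  proof -
    show "v @ [b] \<notin> T" for b
      using v by (cases b) (auto simp: leaves_def)
    then show "v @ [b, c] \<notin> T"
      using prefix[of "v @ [b]" "[c]"] by auto
  qed
  have "leaves (add_caret v T) = insert (v @ [False]) (insert (v @ [True]) (leaves T - {v}))"
    using v notin by (auto simp: leaves_def add_caret_def)
  moreover have "v @ [False] \<notin> leaves T" "v @ [True] \<notin> leaves T"
    using notin by (auto simp: leaves_def)
  ultimately show ?thesis
    using finite_leaves[OF T] v card_Suc_Diff1[of "leaves T" v] by simp
qed

text \<open>A shortest string of \<open>U - T\<close> is a child of a leaf of \<open>T\<close>.\<close>

lemma leaf_to_expand:
  assumes T: "is_tree T" and U: "is_tree U" and "T \<subset> U"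
  obtains v where "v \<in> leaves T" "add_caret v T \<subseteq> U"
proof -
  from \<open>T \<subset> U\<close> obtain u where "u \<in> U - T"
    by blast
  then obtain u where u: "u \<in> U - T" and least: "\<And>w. w \<in> U - T \<Longrightarrow> length u \<le> length w"
    using ex_has_least_nat[of "\<lambda>u. u \<in> U - T" u length] by blast
  have "u \<noteq> []"
    using u root_in_tree[OF T] by auto
  then obtain v b where vb: "u = v @ [b]"
    by (cases u rule: rev_cases) auto
  have "v \<in> U"
    using u U unfolding vb is_tree_def by blast
  then have "v \<in> T"
    using least[of v] vb by auto
  moreover have "v @ [False] \<notin> T \<and> v @ [True] \<notin> T"
    using u T unfolding vb is_tree_def by (cases b) auto
  moreover have "v @ [False] \<in> U \<and> v @ [True] \<in> U"
    using u U unfolding vb is_tree_def by (cases b) auto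
  ultimately show ?thesis
    using that[of v] \<open>T \<subset> U\<close> by (auto simp: leaves_def add_caret_def)
qed

section \<open>Simple forests and the numbering of their leaves\<close>

abbreviation tree_forest :: "tree \<Rightarrow> forest" where
  "tree_forest T \<equiv> forest_one (0 := T)"

lemma tree_forest_in_forests: "is_tree T \<Longrightarrow> tree_forest T \<in> forests"
  unfolding forests_def
  by (auto simp: forest_one_def is_tree_trivial intro: finite_subset[of _ "{0}"])

lemma caret_in_forests: "caret m \<in> forests"
proof -
  have "is_tree {[], [False], [True]}"
    by (auto simp: is_tree_def append_eq_Cons_conv)
  then show ?thesis
    unfolding forests_def
    by (auto simp: caret_def forest_one_def is_tree_trivial intro: finite_subset[of _ "{m}"])
qed

lemma forest_one_in_forests: "forest_one \<in> forests"
  by (simp add: forests_def forest_one_def is_tree_trivial)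

lemma simple_forest_type_iff:
  "simple_forest_type k F \<longleftrightarrow>
     (\<exists>T. F = tree_forest T \<and> is_tree T \<and> card (leaves T) = k + 1)"
proof
  assume F: "simple_forest_type k F"
  then have "F = tree_forest (F 0)"
    by (auto simp: simple_forest_type_def simple_forest_def forest_one_def fun_eq_iff)
  with F show "\<exists>T. F = tree_forest T \<and> is_tree T \<and> card (leaves T) = k + 1"
    by (intro exI[of _ "F 0"])
      (auto simp: simple_forest_type_def simple_forest_def forests_def)
next
  assume "\<exists>T. F = tree_forest T \<and> is_tree T \<and> card (leaves T) = k + 1"
  then show "simple_forest_type k F"
    using tree_forest_in_forests
    by (auto simp: simple_forest_type_def simple_forest_def forest_one_def)
qed

text \<open>Ranks in a finite linear order are injective, and bounded by its size, so every
  number below that size occurs.\<close>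

lemma leaf_number_bij:
  assumes T: "is_tree T"
  shows "bij_betw (leaf_number (tree_forest T) 0) (leaves T) {..<card (leaves T)}"
proof -
  let ?r = "lexord {(False, True)}"
  let ?L = "leaves T"
  let ?n = "leaf_number (tree_forest T) 0"
  note fin = finite_leaves[OF T]
  have n: "?n v = card {w \<in> ?L. (w, v) \<in> ?r}" for v
    by (simp add: leaf_number_def)
  have irrefl: "(v, v) \<notin> ?r" for v
    by (rule lexord_irreflexive) simp
  have trans: "(u, w) \<in> ?r" if "(u, v) \<in> ?r" "(v, w) \<in> ?r" for u v w
    using lexord_trans[OF that] by (simp add: trans_def)
  have total: "(u, v) \<in> ?r \<or> u = v \<or> (v, u) \<in> ?r" for u v
    by (rule lexord_linear) auto
  have mono: "?n v < ?n w" if "v \<in> ?L" "(v, w) \<in> ?r" for v w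
    unfolding n
  proof (rule psubset_card_mono)
    show "{u \<in> ?L. (u, v) \<in> ?r} \<subset> {u \<in> ?L. (u, w) \<in> ?r}"
      using that trans irrefl by blast
  qed (use fin in auto)
  have inj: "inj_on ?n ?L"
  proof (rule inj_onI)
    fix v w assume "v \<in> ?L" "w \<in> ?L" "?n v = ?n w"
    then show "v = w"
      using total[of v w] mono[of v w] mono[of w v] by auto
  qed
  have "?n v < card ?L" if "v \<in> ?L" for v
    unfolding n by (rule psubset_card_mono[OF fin]) (use that irrefl in blast)
  then have "?n ` ?L \<subseteq> {..<card ?L}"
    by auto
  then have "?n ` ?L = {..<card ?L}"
    by (intro card_subset_eq) (auto simp: card_image[OF inj])
  with inj show ?thesis
    by (simp add: bij_betw_def)
qed

lemma forest_mult_one: "forest_mult F forest_one = F"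
  by (auto simp: forest_mult_def forest_one_def trivial_tree_def leaves_def fun_eq_iff)

lemma tree_forest_mult_caret:
  assumes T: "is_tree T" and v: "v \<in> leaves T"
  shows "forest_mult (tree_forest T) (caret (leaf_number (tree_forest T) 0 v))
           = tree_forest (add_caret v T)"
proof (rule ext)
  fix i
  let ?F = "tree_forest T"
  let ?m = "leaf_number ?F 0 v"
  have inj: "leaf_number ?F 0 w = ?m \<longleftrightarrow> w = v" if "w \<in> leaves T" for w
    using leaf_number_bij[OF T] v that by (auto simp: bij_betw_def inj_on_def)
  have less: "?m < card (leaves T)"
    using bij_betw_apply[OF leaf_number_bij[OF T] v] by simp
  show "forest_mult ?F (caret ?m) i = tree_forest (add_caret v T) i"
  proof (cases "i = 0")
    case True
    have "{w @ u | u. u \<in> caret ?m (leaf_number ?F 0 w)}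
        = (if w = v then {v, v @ [False], v @ [True]} else {w})" if "w \<in> leaves T" for w
      using inj[OF that] by (auto simp: caret_def forest_one_def trivial_tree_def)
    then have "(\<Union>w\<in>leaves T. {w @ u | u. u \<in> caret ?m (leaf_number ?F 0 w)})
        = (\<Union>w\<in>leaves T. if w = v then {v, v @ [False], v @ [True]} else {w})"
      by (intro SUP_cong) auto
    also have "\<dots> = leaves T \<union> {v @ [False], v @ [True]}"
      using v by (auto split: if_splits)
    finally show ?thesis
      using True by (auto simp: forest_mult_def add_caret_def leaves_def)
  next
    case False
    \<comment> \<open>The leaves of \<open>T\<close> precede the leaf of the \<open>i\<close>-th tree, which is thus out of reach of \<open>?m\<close>.\<close>
    have "card (leaves (?F 0)) \<le> (\<Sum>j<i. card (leaves (?F j)))"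
      using False by (intro member_le_sum) auto
    then have "leaf_number ?F i [] \<noteq> ?m"
      using less by (simp add: leaf_number_def[of _ i])
    then show ?thesis
      using False leaves_trivial
      by (auto simp: forest_mult_def caret_def forest_one_def trivial_tree_def)
  qed
qed

lemma simple_forest_type_mult_caret:
  assumes F: "simple_forest_type k F" and m: "m < k + 1"
  shows "simple_forest_type (k + 1) (forest_mult F (caret m))"
proof -
  obtain T where T: "F = tree_forest T" "is_tree T" "card (leaves T) = k + 1"
    using F by (auto simp: simple_forest_type_iff)
  have "m \<in> leaf_number F 0 ` leaves T"
    using leaf_number_bij[OF T(2)] m T by (simp add: bij_betw_def)
  then obtain v where "v \<in> leaves T" "leaf_number F 0 v = m"
    by blast
  with T show ?thesis
    unfolding simple_forest_type_iff
    by (intro exI[of _ "add_caret v T"])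
      (use tree_forest_mult_caret is_tree_add_caret card_leaves_add_caret in auto)
qed

section \<open>The strand subgroups and their action on carets\<close>

context zappa_szep
begin

lemma strand_subgroup_subset: "range s \<subseteq> carrier A \<Longrightarrow> strand_subgroup A s k \<subseteq> carrier A"
  unfolding strand_subgroup_def by (intro generate_incl) blast

lemma subgroup_strand_subgroup: "range s \<subseteq> carrier A \<Longrightarrow> subgroup (strand_subgroup A s k) A"
  unfolding strand_subgroup_def by (intro generate_is_subgroup) blast

lemma gen_pow_in_strand_subgroup:
  assumes s: "range s \<subseteq> carrier A" and "q + 2 \<le> k"
  shows "s q [^] (e :: int) \<in> strand_subgroup A s k"
proof -
  have "s q \<in> strand_subgroup A s k"
    using assms(2) by (auto simp: strand_subgroup_def intro: generate.incl)
  then show ?thesis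
    by (rule subgroup_int_pow_closed[OF subgroup_strand_subgroup[OF s]])
qed

text \<open>An element on \<open>k\<close> strands permutes the first \<open>k\<close> carets, and splitting one of these strands in
  two leaves an element on \<open>k + 1\<close> strands. The cocycle rules reduce this to generators.\<close>

lemma act_caret_strand:
  assumes s: "range s \<subseteq> carrier A" and \<alpha>: "\<alpha> \<in> strand_subgroup A s k" and "m < k"
  shows "(\<exists>m'<k. act \<alpha> (caret m) = caret m') \<and> ex \<alpha> (caret m) \<in> strand_subgroup A s (k + 1)"
proof -
  note sub = subgroup_strand_subgroup[OF s, of "k + 1"]
  have gen: "(\<exists>m'<k. act (s q [^] e) (caret m) = caret m') \<and>
      ex (s q [^] e) (caret m) \<in> strand_subgroup A s (k + 1)"
    if "e \<in> {1, - 1 :: int}" "q + 2 \<le> k" "m < k" for e q m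
  proof -
    have "transpose q (Suc q) m < k"
      using that by (auto simp: transpose_def)
    moreover have "s q [^] e \<in> strand_subgroup A s (k + 1)"
      "s (q + 1) [^] e \<in> strand_subgroup A s (k + 1)"
      using that gen_pow_in_strand_subgroup[OF s] by auto
    ultimately show ?thesis
      using act_gen[OF that(1), of q m] ex_gen[OF that(1), of q m] subgroup.m_closed[OF sub]
      by auto
  qed
  show ?thesis
    using \<alpha> \<open>m < k\<close> unfolding strand_subgroup_def[of _ _ k]
  proof (induction arbitrary: m rule: generate.induct)
    case one
    then show ?case
      using act_one ex_one caret_in_forests subgroup.one_closed[OF sub] by auto
  next
    case (incl h)
    then obtain q where q: "h = s q" "q + 2 \<le> k" by auto
    have "s q [^] (1 :: int) = s q"
      using s by (intro int_pow_1) auto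
    then show ?case
      using gen[of 1 q m] incl.prems q by simp
  next
    case (inv h)
    then obtain q where q: "h = s q" "q + 2 \<le> k" by auto
    have "s q [^] (- 1 :: int) = inv (s q)"
      using s int_pow_neg[of "s q" 1] int_pow_1[of "s q"] by auto
    then show ?case
      using gen[of "- 1" q m] inv.prems q by simp
  next
    case (eng \<alpha> \<beta>)
    have closed: "\<alpha> \<in> carrier A" "\<beta> \<in> carrier A"
      using strand_subgroup_subset[OF s, of k] eng.hyps by (auto simp: strand_subgroup_def)
    obtain m' where "m' < k" "act \<beta> (caret m) = caret m'"
      using eng.IH(2) eng.prems by blast
    then show ?case
      using eng.IH(1)[of m'] eng.IH(2)[of m] eng.prems act_mult ex_mult closed caret_in_forests
        subgroup.m_closed[OF sub] by auto
  qed
qed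

end

section \<open>Fractions of simple elements\<close>

locale zappa_szep_fractions = zappa_szep A s act ex + G: group G
  for A :: "'a monoid" (structure) and s act ex and G :: "'g monoid" +
  fixes \<iota> :: "forest \<times> 'a \<Rightarrow> 'g"
  assumes gen_closed: "range s \<subseteq> carrier A"
    and embed_hom: "\<iota> \<in> hom (zs_product A act ex) G"
begin

abbreviation "V \<equiv> simple_balanced_fractions A s (zs_product A act ex) G \<iota>"

lemmas strand_subset = strand_subgroup_subset[OF gen_closed]
lemmas strand_subgroup = subgroup_strand_subgroup[OF gen_closed]

lemma embed_closed: "u \<in> forests \<Longrightarrow> \<alpha> \<in> carrier A \<Longrightarrow> \<iota> (u, \<alpha>) \<in> carrier G"
  using hom_in_carrier[OF embed_hom] by (simp add: zs_product_def)

lemma embed_mult: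
  assumes "u \<in> forests" "v \<in> forests" "\<alpha> \<in> carrier A" "\<beta> \<in> carrier A"
  shows "\<iota> (forest_mult u (act \<alpha> v), ex \<alpha> v \<otimes> \<beta>) = \<iota> (u, \<alpha>) \<otimes>\<^bsub>G\<^esub> \<iota> (v, \<beta>)"
  using hom_mult[OF embed_hom, of "(u, \<alpha>)" "(v, \<beta>)"] assms by (simp add: zs_product_def)

lemma simple_forest_in_forests: "simple_forest_type k F \<Longrightarrow> F \<in> forests"
  by (simp add: simple_forest_type_def simple_forest_def)

lemma simple_embed_closed:
  "simple_forest_type k F \<Longrightarrow> \<alpha> \<in> strand_subgroup A s j \<Longrightarrow> \<iota> (F, \<alpha>) \<in> carrier G"
  using embed_closed simple_forest_in_forests strand_subset by blast

lemma fraction_cancel: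
  assumes "x \<in> carrier G" "y \<in> carrier G" "z \<in> carrier G"
  shows "(x \<otimes>\<^bsub>G\<^esub> z) \<otimes>\<^bsub>G\<^esub> inv\<^bsub>G\<^esub> (y \<otimes>\<^bsub>G\<^esub> z) = x \<otimes>\<^bsub>G\<^esub> inv\<^bsub>G\<^esub> y"
proof -
  have "z \<otimes>\<^bsub>G\<^esub> (inv\<^bsub>G\<^esub> z \<otimes>\<^bsub>G\<^esub> inv\<^bsub>G\<^esub> y) = inv\<^bsub>G\<^esub> y"
    using assms G.m_assoc[of z "inv\<^bsub>G\<^esub> z" "inv\<^bsub>G\<^esub> y"] by simp
  then show ?thesis
    using assms by (simp add: G.inv_mult_group G.m_assoc)
qed

lemma fractions_iff:
  "g \<in> V \<longleftrightarrow> (\<exists>k F \<alpha> H \<beta>. simple_forest_type k F \<and> simple_forest_type k H \<and>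
     \<alpha> \<in> strand_subgroup A s (k + 1) \<and> \<beta> \<in> strand_subgroup A s (k + 1) \<and>
     g = \<iota> (F, \<alpha>) \<otimes>\<^bsub>G\<^esub> inv\<^bsub>G\<^esub> \<iota> (H, \<beta>))" (is "_ \<longleftrightarrow> ?R")
proof
  show "g \<in> V \<Longrightarrow> ?R"
    unfolding simple_balanced_fractions_def simple_balanced_def simple_type_def representative_def
    by force
next
  assume ?R
  then obtain k F \<alpha> H \<beta> where *: "simple_forest_type k F" "simple_forest_type k H"
    "\<alpha> \<in> strand_subgroup A s (k + 1)" "\<beta> \<in> strand_subgroup A s (k + 1)"
    "g = \<iota> (F, \<alpha>) \<otimes>\<^bsub>G\<^esub> inv\<^bsub>G\<^esub> \<iota> (H, \<beta>)" by blast
  have "representative (zs_product A act ex) G \<iota> ((F, \<alpha>), (H, \<beta>)) g"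
    using * simple_forest_in_forests strand_subset
    by (auto simp: representative_def zs_product_def)
  moreover have "simple_balanced A s ((F, \<alpha>), (H, \<beta>))"
    using * by (auto simp: simple_balanced_def simple_type_def)
  moreover have "g \<in> carrier G"
    using * simple_embed_closed by simp
  ultimately show "g \<in> V"
    unfolding simple_balanced_fractions_def by blast
qed

text \<open>A normal form for fractions, with the group part collected in the numerator, so that the
  denominator depends on the tree \<open>T\<close> alone and can be matched with that of another fraction.\<close>

definition has_denominator :: "'g \<Rightarrow> tree \<Rightarrow> bool" where
  "has_denominator g T \<longleftrightarrow> is_tree T \<and>
     (\<exists>k F \<eta>. card (leaves T) = k + 1 \<and> simple_forest_type k F \<and> \<eta> \<in> strand_subgroup A s (k + 1) \<and>
       g = \<iota> (F, \<eta>) \<otimes>\<^bsub>G\<^esub> inv\<^bsub>G\<^esub> \<iota> (tree_forest T, \<one>))"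

lemma fraction_has_denominator:
  assumes "g \<in> V"
  obtains T where "has_denominator g T"
proof -
  obtain k F \<alpha> H \<beta> where FH: "simple_forest_type k F" "simple_forest_type k H"
    and \<alpha>\<beta>: "\<alpha> \<in> strand_subgroup A s (k + 1)" "\<beta> \<in> strand_subgroup A s (k + 1)"
    and g: "g = \<iota> (F, \<alpha>) \<otimes>\<^bsub>G\<^esub> inv\<^bsub>G\<^esub> \<iota> (H, \<beta>)"
    using assms unfolding fractions_iff by blast
  obtain T where T: "H = tree_forest T" "is_tree T" "card (leaves T) = k + 1"
    using FH by (auto simp: simple_forest_type_iff)
  have inv_\<beta>: "inv \<beta> \<in> strand_subgroup A s (k + 1)"
    using \<alpha>\<beta> subgroup.m_inv_closed[OF strand_subgroup] by blast
  have closed: "\<alpha> \<in> carrier A" "\<beta> \<in> carrier A" "F \<in> forests" "H \<in> forests"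
    using \<alpha>\<beta> strand_subset FH simple_forest_in_forests by auto
  have shift: "\<iota> (K, \<gamma>) \<otimes>\<^bsub>G\<^esub> \<iota> (forest_one, inv \<beta>) = \<iota> (K, \<gamma> \<otimes> inv \<beta>)"
    if "K \<in> forests" "\<gamma> \<in> carrier A" for K \<gamma>
    using embed_mult[OF that(1) forest_one_in_forests that(2), of "inv \<beta>"] that closed
    by (simp add: act_forest_one ex_forest_one forest_mult_one)
  have "g = (\<iota> (F, \<alpha>) \<otimes>\<^bsub>G\<^esub> \<iota> (forest_one, inv \<beta>)) \<otimes>\<^bsub>G\<^esub>
      inv\<^bsub>G\<^esub> (\<iota> (H, \<beta>) \<otimes>\<^bsub>G\<^esub> \<iota> (forest_one, inv \<beta>))"
    unfolding g using closed forest_one_in_forests embed_closed by (simp add: fraction_cancel)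
  also have "\<dots> = \<iota> (F, \<alpha> \<otimes> inv \<beta>) \<otimes>\<^bsub>G\<^esub> inv\<^bsub>G\<^esub> \<iota> (tree_forest T, \<one>)"
    using closed by (simp add: shift T(1))
  finally have "has_denominator g T"
    unfolding has_denominator_def
    using T FH subgroup.m_closed[OF strand_subgroup \<alpha>\<beta>(1) inv_\<beta>] by blast
  then show thesis
    by (rule that)
qed

text \<open>Numerator and denominator are multiplied by the caret at the leaf \<open>v\<close> of the denominator. The
  group part moves it to a possibly different leaf of the numerator.\<close>

lemma fraction_add_caret:
  assumes g: "has_denominator g T" and v: "v \<in> leaves T"
  shows "has_denominator g (add_caret v T)"
proof -
  obtain k F \<eta> where T: "is_tree T" "card (leaves T) = k + 1"
    and F: "simple_forest_type k F" and \<eta>: "\<eta> \<in> strand_subgroup A s (k + 1)"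
    and g: "g = \<iota> (F, \<eta>) \<otimes>\<^bsub>G\<^esub> inv\<^bsub>G\<^esub> \<iota> (tree_forest T, \<one>)"
    using g by (auto simp: has_denominator_def)
  define m where "m = leaf_number (tree_forest T) 0 v"
  have m: "m < k + 1"
    using bij_betw_apply[OF leaf_number_bij[OF T(1)] v] T(2) by (simp add: m_def)
  obtain m' where m': "m' < k + 1" "act \<eta> (caret m) = caret m'"
    and \<eta>': "ex \<eta> (caret m) \<in> strand_subgroup A s (k + 1 + 1)"
    using act_caret_strand[OF gen_closed \<eta> m] by blast
  have closed: "\<eta> \<in> carrier A" "F \<in> forests" "tree_forest T \<in> forests"
      "ex \<eta> (caret m) \<in> carrier A" "caret m \<in> forests"
    using \<eta> \<eta>' strand_subset F T simple_forest_in_forests tree_forest_in_forests caret_in_forests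
    by auto
  have num: "\<iota> (F, \<eta>) \<otimes>\<^bsub>G\<^esub> \<iota> (caret m, \<one>) = \<iota> (forest_mult F (caret m'), ex \<eta> (caret m))"
    using embed_mult[of F "caret m" \<eta> \<one>] closed m' by simp
  have den: "\<iota> (tree_forest T, \<one>) \<otimes>\<^bsub>G\<^esub> \<iota> (caret m, \<one>) = \<iota> (tree_forest (add_caret v T), \<one>)"
    using embed_mult[of "tree_forest T" "caret m" \<one> \<one>] closed tree_forest_mult_caret[OF T(1) v]
    by (simp add: act_one ex_one m_def)
  have "g = (\<iota> (F, \<eta>) \<otimes>\<^bsub>G\<^esub> \<iota> (caret m, \<one>)) \<otimes>\<^bsub>G\<^esub>
      inv\<^bsub>G\<^esub> (\<iota> (tree_forest T, \<one>) \<otimes>\<^bsub>G\<^esub> \<iota> (caret m, \<one>))"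
    unfolding g using closed embed_closed by (simp add: fraction_cancel)
  then have "g = \<iota> (forest_mult F (caret m'), ex \<eta> (caret m)) \<otimes>\<^bsub>G\<^esub>
      inv\<^bsub>G\<^esub> \<iota> (tree_forest (add_caret v T), \<one>)"
    by (simp only: num den)
  moreover have "card (leaves (add_caret v T)) = (k + 1) + 1"
    using card_leaves_add_caret[OF T(1) v] T(2) by simp
  ultimately show ?thesis
    unfolding has_denominator_def
    using is_tree_add_caret[OF T(1) v] simple_forest_type_mult_caret[OF F m'(1)] \<eta>' by blast
qed

lemma fraction_grow:
  assumes "has_denominator g T" "is_tree U" "T \<subseteq> U"
  shows "has_denominator g U"
  using assms
proof (induction "card (U - T)" arbitrary: T rule: less_induct)
  case less
  have T: "is_tree T"
    using less.prems by (simp add: has_denominator_def)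
  show ?case
  proof (cases "T = U")
    case True
    with less.prems show ?thesis by simp
  next
    case False
    then obtain v where v: "v \<in> leaves T" "add_caret v T \<subseteq> U"
      using leaf_to_expand[OF T \<open>is_tree U\<close>] less.prems by blast
    have "U - add_caret v T \<subset> U - T"
      using v by (auto simp: add_caret_def leaves_def)
    then have "card (U - add_caret v T) < card (U - T)"
      using \<open>is_tree U\<close> by (intro psubset_card_mono) (auto simp: is_tree_def)
    then show ?thesis
      using less.hyps fraction_add_caret less.prems v by blast
  qed
qed

lemma fractions_subset: "V \<subseteq> carrier G"
  by (auto simp: simple_balanced_fractions_def)

lemma fractions_one: "\<one>\<^bsub>G\<^esub> \<in> V"
proof -
  have "simple_forest_type 0 (tree_forest trivial_tree)"
    unfolding simple_forest_type_iff using is_tree_trivial leaves_trivial by auto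
  moreover have one: "\<one> \<in> strand_subgroup A s (0 + 1)"
    using subgroup.one_closed[OF strand_subgroup] .
  moreover have "\<one>\<^bsub>G\<^esub> = \<iota> (tree_forest trivial_tree, \<one>) \<otimes>\<^bsub>G\<^esub> inv\<^bsub>G\<^esub> \<iota> (tree_forest trivial_tree, \<one>)"
    using simple_embed_closed calculation by (metis G.r_inv)
  ultimately show ?thesis
    unfolding fractions_iff by blast
qed

lemma fractions_inv:
  assumes "g \<in> V"
  shows "inv\<^bsub>G\<^esub> g \<in> V"
proof -
  obtain k F \<alpha> H \<beta> where *: "simple_forest_type k F" "simple_forest_type k H"
    "\<alpha> \<in> strand_subgroup A s (k + 1)" "\<beta> \<in> strand_subgroup A s (k + 1)"
    and g: "g = \<iota> (F, \<alpha>) \<otimes>\<^bsub>G\<^esub> inv\<^bsub>G\<^esub> \<iota> (H, \<beta>)"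
    using assms unfolding fractions_iff by blast
  have "inv\<^bsub>G\<^esub> g = \<iota> (H, \<beta>) \<otimes>\<^bsub>G\<^esub> inv\<^bsub>G\<^esub> \<iota> (F, \<alpha>)"
    unfolding g using * simple_embed_closed by (simp add: G.inv_mult_group)
  then show ?thesis
    unfolding fractions_iff using * by blast
qed

lemma fractions_mult:
  assumes g: "g \<in> V" and h: "h \<in> V"
  shows "g \<otimes>\<^bsub>G\<^esub> h \<in> V"
proof -
  obtain T where T: "has_denominator g T"
    using fraction_has_denominator[OF g] .
  obtain U where U: "has_denominator (inv\<^bsub>G\<^esub> h) U"
    using fraction_has_denominator[OF fractions_inv[OF h]] .
  have tree: "is_tree (T \<union> U)"
    using T U by (intro is_tree_Un) (simp_all add: has_denominator_def)
  have "has_denominator g (T \<union> U)" "has_denominator (inv\<^bsub>G\<^esub> h) (T \<union> U)"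
    using fraction_grow[OF T tree] fraction_grow[OF U tree] by auto
  then obtain k F \<eta> H \<theta> where k: "card (leaves (T \<union> U)) = k + 1"
    and F: "simple_forest_type k F" "\<eta> \<in> strand_subgroup A s (k + 1)"
    and H: "simple_forest_type k H" "\<theta> \<in> strand_subgroup A s (k + 1)"
    and g_eq: "g = \<iota> (F, \<eta>) \<otimes>\<^bsub>G\<^esub> inv\<^bsub>G\<^esub> \<iota> (tree_forest (T \<union> U), \<one>)"
    and h_eq: "inv\<^bsub>G\<^esub> h = \<iota> (H, \<theta>) \<otimes>\<^bsub>G\<^esub> inv\<^bsub>G\<^esub> \<iota> (tree_forest (T \<union> U), \<one>)"
    by (auto simp: has_denominator_def)
  have closed: "\<iota> (F, \<eta>) \<in> carrier G" "\<iota> (H, \<theta>) \<in> carrier G"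
      "\<iota> (tree_forest (T \<union> U), \<one>) \<in> carrier G"
    using F H simple_embed_closed embed_closed tree_forest_in_forests[OF tree] by auto
  have "h = inv\<^bsub>G\<^esub> (inv\<^bsub>G\<^esub> h)"
    using h fractions_subset by (metis G.inv_inv subsetD)
  then have "g \<otimes>\<^bsub>G\<^esub> h = g \<otimes>\<^bsub>G\<^esub> inv\<^bsub>G\<^esub> (inv\<^bsub>G\<^esub> h)"
    by simp
  also have "\<dots> = \<iota> (F, \<eta>) \<otimes>\<^bsub>G\<^esub> inv\<^bsub>G\<^esub> \<iota> (H, \<theta>)"
    unfolding g_eq h_eq using closed by (simp add: fraction_cancel)
  finally show ?thesis
    unfolding fractions_iff using F H by blast
qed

theorem group_simple_balanced_fractions: "group (G\<lparr>carrier := V\<rparr>)"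
proof -
  have "subgroup V G"
    using fractions_subset fractions_mult fractions_one fractions_inv by (intro subgroup.intro)
  then show ?thesis
    by (rule G.subgroup_imp_group)
qed

end

section \<open>Permutations and braids\<close>

lemma S_gen_closed: "range S_gen \<subseteq> carrier S_inf"
proof -
  have "{i. transpose m (Suc m) i \<noteq> i} \<subseteq> {m, Suc m}" for m
    by (auto simp: transpose_def)
  then show ?thesis
    by (auto simp: S_inf_def S_gen_def intro: finite_subset)
qed

lemma braid_gen_closed: "range braid_gen \<subseteq> carrier B_inf"
  by (simp add: B_inf_def)

lemma zappa_szep_fractionsI:
  assumes "zappa_szep A s act ex" "range s \<subseteq> carrier A"
    and "right_fraction_group (zs_product A act ex) G \<iota>"
  shows "zappa_szep_fractions A s act ex G \<iota>"
  using assms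
  by (auto simp: zappa_szep_fractions_def zappa_szep_fractions_axioms_def right_fraction_group_def)

theorem theorem4:
  fixes actS :: "(nat \<Rightarrow> nat) \<Rightarrow> forest \<Rightarrow> forest"
    and exS :: "(nat \<Rightarrow> nat) \<Rightarrow> forest \<Rightarrow> (nat \<Rightarrow> nat)"
    and actB :: "braid \<Rightarrow> forest \<Rightarrow> forest"
    and exB :: "braid \<Rightarrow> forest \<Rightarrow> braid"
    and V_hat :: "'v monoid" and \<iota>S :: "forest \<times> (nat \<Rightarrow> nat) \<Rightarrow> 'v"
    and BV_hat :: "'b monoid" and \<iota>B :: "forest \<times> braid \<Rightarrow> 'b"
  assumes "zappa_szep S_inf S_gen actS exS"
    and "zappa_szep B_inf braid_gen actB exB"
    and "right_fraction_group (zs_product S_inf actS exS) V_hat \<iota>S"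
    and "right_fraction_group (zs_product B_inf actB exB) BV_hat \<iota>B"
  shows "group (V_hat\<lparr>carrier :=
            simple_balanced_fractions S_inf S_gen (zs_product S_inf actS exS) V_hat \<iota>S\<rparr>) \<and>
         group (BV_hat\<lparr>carrier :=
            simple_balanced_fractions B_inf braid_gen (zs_product B_inf actB exB) BV_hat \<iota>B\<rparr>)"
  using assms S_gen_closed braid_gen_closed
  by (intro conjI zappa_szep_fractions.group_simple_balanced_fractions zappa_szep_fractionsI)

end
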